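(* Let $\xi$ be a positive irrational number, let $M=\{a+b\xi:a,b\in\mathbb{Z},\ a+b\xi\geq0\}$, and for $l\in\mathbb{P}$ let $B(l)\subseteq M$ and $n_l=l+l^3$ be as defined in the context. There exist sequences $\alpha_i,\beta_i,\gamma_i$ $(i\in\mathbb{P})$ of elements of $M$ satisfying: (i) $\lim_{i\to\infty}\alpha_i=0$; (ii) $\lim_{i\to\infty}\gamma_i=1$; (iii) $\gamma_i>1$ for all $i\in\mathbb{P}$; (iv) $\beta_i+\gamma_i=4$ for all $i\in\mathbb{P}$; and (v) $S_n(\Sigma)\cap B(l)=\varnothing$ for all $l\in\mathbb{P}$ and all integers $n>n_l$, where $\Sigma=\{\alpha_i,\beta_i,\gamma_i:i\in\mathbb{P}\}$.
   Context: $\mathbb{P}=\{1,2,3,\ldots\}$. Here $a,b$ in $a+b\xi\in M$ may be negative, but $a+b\xi\ge0$; $M$ is an additive submonoid of $\mathbb{R}_{\ge0}$. Since $1$ and $\xi$ are linearly independent over $\mathbb{Q}$, there is a well-defined monoid homomorphism $\phi:M\to\mathbb{Z}$, $\phi(a+b\xi)=b$. For $l\in\mathbb{P}$, $B(l)=\{x\in M:\ 0\le x<l\ \text{and}\ -l<\phi(x)<l\}$ and $n_l=l+l^3$. For $\Sigma\subseteq\mathbb{R}$ and $n\in\mathbb{P}$, $S_n(\Sigma)=\{\sigma_1+\cdots+\sigma_n:\sigma_1,\ldots,\sigma_n\in\Sigma\}$ (repetitions allowed). *)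

theory Defs
  imports Complex_Main
begin

definition M :: "real \<Rightarrow> real set" where
  "M \<xi> = {x. x \<ge> 0 \<and> (\<exists>a b :: int. x = of_int a + of_int b * \<xi>)}"

text \<open>The coefficient of \<open>\<xi>\<close>; it is meaningful only for irrational \<open>\<xi>\<close> and on \<open>M \<xi>\<close>
  (see \<open>phi_eq\<close> below).\<close>

definition phi :: "real \<Rightarrow> real \<Rightarrow> int" where
  "phi \<xi> x = (THE b. \<exists>a :: int. x = of_int a + of_int b * \<xi>)"

lemma phi_eq:
  fixes a b :: int
  assumes "\<xi> \<notin> \<rat>"
  shows "phi \<xi> (of_int a + of_int b * \<xi>) = b"
  unfolding phi_def
proof (rule the_equality)
  show "\<exists>a'. real_of_int a + of_int b * \<xi> = of_int a' + of_int b * \<xi>" by blast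
next
  fix c assume "\<exists>a'. real_of_int a + of_int b * \<xi> = of_int a' + of_int c * \<xi>"
  then obtain a' where eq: "real_of_int a + of_int b * \<xi> = of_int a' + of_int c * \<xi>" by blast
  show "c = b"
  proof (rule ccontr)
    assume "c \<noteq> b"
    with eq have "\<xi> = of_int (a - a') / of_int (c - b)" by (simp add: field_simps)
    also have "\<dots> \<in> \<rat>" by (intro Rats_divide Rats_of_int)
    finally show False using assms by blast
  qed
qed

definition B :: "real \<Rightarrow> nat \<Rightarrow> real set" where
  "B \<xi> l = {x \<in> M \<xi>. 0 \<le> x \<and> x < of_nat l \<and> - int l < phi \<xi> x \<and> phi \<xi> x < int l}"

definition n_bound :: "nat \<Rightarrow> nat" where
  "n_bound l = l + l ^ 3"

definition S :: "nat \<Rightarrow> real set \<Rightarrow> real set" where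
  "S n \<Sigma> = {(\<Sum>k=1..n. \<sigma> k) | \<sigma>. \<forall>k\<in>{1..n}. \<sigma> k \<in> \<Sigma>}"

end

theory Submission
  imports Defs "HOL-Analysis.Kronecker_Approximation_Theorem"
begin

text \<open>By density, choose \<open>\<alpha>\<^sub>i\<close> of size about \<open>1/i\<close> and \<open>\<gamma>\<^sub>i\<close> slightly above \<open>1\<close>, with positive coefficients
  \<open>a\<^sub>i = \<phi>(\<alpha>\<^sub>i)\<close> and \<open>g\<^sub>i = \<phi>(\<gamma>\<^sub>i) = - \<phi>(\<beta>\<^sub>i)\<close> such that \<open>a\<^sub>0, g\<^sub>0, a\<^sub>1, g\<^sub>1, \<dots>\<close> grows very fast.
  A sum \<open>x < l\<close> of more than \<open>l + l\<^sup>3\<close> elements has fewer than \<open>l\<close> terms \<open>\<beta>\<^sub>i, \<gamma>\<^sub>i\<close>, hence more than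
  \<open>l\<^sup>3\<close> terms \<open>\<alpha>\<^sub>i\<close>; as these sum to less than \<open>l\<close>, the largest index \<open>K\<close> among them is at least
  \<open>l - 1\<close>. Let \<open>J\<close> be the largest index for which the contributions of the \<open>\<beta>\<^sub>J\<close> and \<open>\<gamma>\<^sub>J\<close> do not cancel
  in \<open>\<phi>(x)\<close>. If \<open>J < K\<close> or nothing is left, then \<open>a\<^sub>K\<close> absorbs the remaining \<open>g\<^sub>j\<close> and the other
  \<open>\<alpha>\<close>-terms make \<open>\<phi>(x) \<ge> l\<close>; otherwise \<open>g\<^sub>J\<close> dominates all other terms.\<close>

section \<open>Density of integer combinations of 1 and \<xi> with large coefficients of
  \<xi>\<close>

lemma irrational_combination_in_interval:
  fixes \<xi> u v :: real and N :: int
  assumes "\<xi> \<notin> \<rat>" and "u < v"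
  obtains c b :: int where "b \<ge> N" "u < of_int c + of_int b * \<xi>" "of_int c + of_int b * \<xi> < v"
proof -
  \<comment> \<open>Kronecker's theorem gives a positive multiplier but no lower bound on it.
    Applying it to \<open>m * \<xi>\<close>, which is still irrational, makes the coefficient a
    positive multiple \<open>k * m\<close> and hence at least \<open>N\<close>.\<close>
  define m where "m = max 1 N"
  have m: "m > 0" "m \<ge> N" by (auto simp: m_def)
  have irr: "of_int m * \<xi> \<notin> \<rat>"
  proof
    assume "of_int m * \<xi> \<in> \<rat>"
    then have "of_int m * \<xi> / of_int m \<in> \<rat>" by (intro Rats_divide Rats_of_int)
    with m(1) assms(1) show False by simp
  qed
  obtain h k where k: "k > 0" "\<bar>of_int k * (of_int m * \<xi>) - of_int h - (u + v) / 2\<bar> < (v - u) / 2"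
    by (rule sequence_of_fractional_parts_is_dense[OF irr, of "(v - u) / 2" "(u + v) / 2"])
       (use assms(2) in auto)
  have "k * m \<ge> 1 * m" using k(1) m(1) by (intro mult_right_mono) auto
  then have "k * m \<ge> N" using m(2) by linarith
  moreover have "u < of_int (- h) + of_int (k * m) * \<xi>" "of_int (- h) + of_int (k * m) * \<xi> < v"
    using k(2) unfolding abs_less_iff by (auto simp: field_simps)
  ultimately show thesis using that by blast
qed

text \<open>The factor \<open>int i + 2\<close> lets \<open>a (Suc i)\<close> outweigh a signed sum
  of up to \<open>i + 2\<close> values \<open>g j\<close> with \<open>j \<le> i\<close>. The square
  lets \<open>g i\<close> outweigh up to \<open>(i + 1) * (i + 2)\<close> values \<open>a j\<close>
  with \<open>j \<le> i\<close>, with a margin of \<open>(i + 2) * a i\<close>.\<close>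

definition lacunary :: "(nat \<Rightarrow> int) \<Rightarrow> (nat \<Rightarrow> int) \<Rightarrow> bool" where
  "lacunary a g \<longleftrightarrow>
    (\<forall>i. a i > 0 \<and> g i \<ge> (int i + 2)\<^sup>2 * a i \<and> a (Suc i) \<ge> (int i + 2) * g i)"

lemma lacunary_approximations:
  fixes \<xi> :: real
  assumes "\<xi> \<notin> \<rat>"
  obtains p a q g :: "nat \<Rightarrow> int" where "lacunary a g"
    "\<And>i. 1 / (real i + 2) < of_int (p i) + of_int (a i) * \<xi>"
    "\<And>i. of_int (p i) + of_int (a i) * \<xi> < 1 / (real i + 1)"
    "\<And>i. 1 < of_int (q i) + of_int (g i) * \<xi>"
    "\<And>i. of_int (q i) + of_int (g i) * \<xi> < 1 + 1 / (real i + 1)"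
proof -
  \<comment> \<open>\<open>P\<close> holds the conditions within one index and \<open>Q\<close> the
    growth from one index to the next. Density allows any lower bound on a coefficient, so each
    \<open>a\<close> can be chosen after the previous \<open>g\<close>, and each \<open>g\<close>
    after its own \<open>a\<close>.\<close>
  define P where "P = (\<lambda>(i::nat) (p, a, q, g).
    1 / (real i + 2) < of_int p + of_int a * \<xi> \<and> of_int p + of_int a * \<xi> < 1 / (real i + 1) \<and>
    1 < of_int q + of_int g * \<xi> \<and> of_int q + of_int g * \<xi> < 1 + 1 / (real i + 1) \<and>
    a > 0 \<and> g \<ge> (int i + 2)\<^sup>2 * a)"
  define Q where "Q = (\<lambda>(i::nat) (p::int, a::int, q::int, g::int) (p'::int, a'::int, q'::int, g'::int).
    a' \<ge> (int i + 2) * g)"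
  have ex: "\<exists>p a q g. P i (p, a, q, g) \<and> a \<ge> N" for i and N :: int
  proof -
    have "1 / (real i + 2) < 1 / (real i + 1)" by (simp add: field_simps)
    then obtain p a where pa: "a \<ge> max 1 N" "1 / (real i + 2) < of_int p + of_int a * \<xi>"
      "of_int p + of_int a * \<xi> < 1 / (real i + 1)"
      by (rule irrational_combination_in_interval[OF assms])
    have "(1::real) < 1 + 1 / (real i + 1)" by simp
    then obtain q g where "g \<ge> (int i + 2)\<^sup>2 * a" "1 < of_int q + of_int g * \<xi>"
      "of_int q + of_int g * \<xi> < 1 + 1 / (real i + 1)"
      by (rule irrational_combination_in_interval[OF assms])
    with pa have "P i (p, a, q, g) \<and> a \<ge> N" by (simp add: P_def)
    then show ?thesis by blast
  qed
  have "\<exists>f. \<forall>n. P n (f n) \<and> Q n (f n) (f (Suc n))"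
  proof (rule dependent_nat_choice)
    show "\<exists>x. P 0 x" using ex by blast
    show "\<exists>y. P (Suc n) y \<and> Q n x y" for x n
      using ex[of "Suc n" "(int n + 2) * snd (snd (snd x))"]
      by (auto simp: Q_def split: prod.splits) blast
  qed
  then obtain f where f: "\<And>n. P n (f n)" "\<And>n. Q n (f n) (f (Suc n))" by blast
  show thesis
  proof
    show "lacunary (\<lambda>i. fst (snd (f i))) (\<lambda>i. snd (snd (snd (f i))))"
      using f by (simp add: lacunary_def P_def Q_def case_prod_beta)
  qed (use f(1) in \<open>auto simp: P_def case_prod_beta\<close>)
qed

section \<open>Domination estimates for lacunary coefficients\<close>

lemma lacunary_pos: "lacunary a g \<Longrightarrow> 0 < a i"
  by (simp add: lacunary_def)

lemma lacunary_le:
  assumes "lacunary a g"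
  shows "a i \<le> g i"
proof -
  have "1 * a i \<le> (int i + 2)\<^sup>2 * a i"
    using lacunary_pos[OF assms, of i]
    by (intro mult_right_mono) (auto simp: power2_eq_square algebra_simps)
  also have "\<dots> \<le> g i" using assms by (simp add: lacunary_def)
  finally show ?thesis by simp
qed

lemma lacunary_step:
  assumes "lacunary a g" and "j < i" and "l \<le> i + 1"
  shows "int l * g j \<le> a i"
proof -
  have pos: "0 < g i" for i
    using lacunary_pos[OF assms(1), of i] lacunary_le[OF assms(1), of i] by linarith
  have Suc: "(int i + 2) * g i \<le> a (Suc i)" for i
    using assms(1) by (simp add: lacunary_def)
  have "g i \<le> g (Suc i)" for i
  proof -
    have "1 * g i \<le> (int i + 2) * g i" using pos[of i] by (intro mult_right_mono) auto
    with Suc[of i] lacunary_le[OF assms(1), of "Suc i"] show ?thesis by linarith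
  qed
  then have mono: "g j \<le> g k" if "j \<le> k" for j k using that by (rule lift_Suc_mono_le)
  obtain m where m: "i = Suc m" using assms(2) by (cases i) auto
  \<comment> \<open>For \<open>i = Suc m\<close> the bound \<open>l \<le> i + 1\<close> reads
    \<open>l \<le> m + 2\<close>, which is exactly the growth factor from \<open>g m\<close> to
    \<open>a i\<close>.\<close>
  have "int l * g j \<le> (int m + 2) * g m"
    using assms m mono[of j m] pos[of j] by (intro mult_mono) auto
  then show ?thesis using Suc[of m] m by simp
qed

text \<open>Each \<open>g j\<close> is at most \<open>a i / l\<close> and the weights add up to at
  most \<open>l\<close>. To stay in the integers, the estimate is multiplied by \<open>l\<close> and
  cancelled at the end.\<close>

lemma lacunary_sum_bound:
  fixes d :: "nat \<Rightarrow> int"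
  assumes "lacunary a g" and "finite F" and "\<And>j. j \<in> F \<Longrightarrow> j < i" and "l \<le> i + 1" and "l > 0"
    and "(\<Sum>j\<in>F. \<bar>d j\<bar>) \<le> int l"
  shows "\<bar>\<Sum>j\<in>F. d j * g j\<bar> \<le> a i"
proof -
  have ai: "a i > 0" by (rule lacunary_pos[OF assms(1)])
  have g0: "g j > 0" for j
    using lacunary_pos[OF assms(1), of j] lacunary_le[OF assms(1), of j] by linarith
  have "int l * \<bar>\<Sum>j\<in>F. d j * g j\<bar> \<le> int l * (\<Sum>j\<in>F. \<bar>d j\<bar> * g j)"
    using sum_abs[of "\<lambda>j. d j * g j" F] g0
    by (intro mult_left_mono) (auto simp: abs_mult less_imp_le abs_of_pos)
  also have "\<dots> = (\<Sum>j\<in>F. \<bar>d j\<bar> * (int l * g j))"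
    by (simp add: sum_distrib_left mult_ac)
  also have "\<dots> \<le> (\<Sum>j\<in>F. \<bar>d j\<bar> * a i)"
    using lacunary_step[OF assms(1)] assms(3,4) by (intro sum_mono mult_left_mono) auto
  also have "\<dots> = (\<Sum>j\<in>F. \<bar>d j\<bar>) * a i" by (simp add: sum_distrib_right)
  also have "\<dots> \<le> int l * a i" using assms(6) ai by (intro mult_right_mono) auto
  finally show ?thesis using assms(5) by simp
qed

text \<open>The combinatorial core, free of \<xi>: \<open>A\<close> lists the \<alpha>-terms and
  \<open>D\<close> the others, with sign 1 for \<gamma> and -1 for \<beta>. The sum is then the
  value of \<open>phi\<close>.\<close>

lemma lacunary_signed_sum_large:
  fixes s :: "'a \<Rightarrow> int" and ind :: "'a \<Rightarrow> nat"
  assumes lac: "lacunary a g" and fin: "finite A" "finite D"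
    and l: "l > 0" "l \<le> K + 1" and cD: "card D \<le> l"
    and cA: "l < card A" "card A \<le> l * (K + 2)"
    and K: "K \<in> ind ` A" "\<And>k. k \<in> A \<Longrightarrow> ind k \<le> K"
    and s: "\<And>k. k \<in> D \<Longrightarrow> \<bar>s k\<bar> = 1"
  shows "int l \<le> \<bar>(\<Sum>k\<in>A. a (ind k)) + (\<Sum>k\<in>D. s k * g (ind k))\<bar>"
proof -
  define d where "d j = (\<Sum>k | k \<in> D \<and> ind k = j. s k)" for j
  define T where "T = {j \<in> ind ` D. d j \<noteq> 0}"
  have finT: "finite T" using fin by (simp add: T_def)
  have apos: "a i > 0" for i by (rule lacunary_pos[OF lac])
  have a_mono: "a i \<le> a j" if "i \<le> j" for i j
  proof (cases "i = j")
    case False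
    then show ?thesis
      using lacunary_step[OF lac, of i j 1] lacunary_le[OF lac, of i] that by simp
  qed simp
  have "(\<Sum>k\<in>D. s k * g (ind k)) = (\<Sum>j\<in>ind ` D. d j * g j)"
    unfolding d_def sum_distrib_right
    by (subst sum.group[OF fin(2), of "ind ` D" ind "\<lambda>k. s k * g (ind k)", symmetric])
       (auto intro!: sum.cong simp: fin)
  also have "\<dots> = (\<Sum>j\<in>T. d j * g j)"
    using fin by (intro sum.mono_neutral_right) (auto simp: T_def)
  finally have D_eq: "(\<Sum>k\<in>D. s k * g (ind k)) = (\<Sum>j\<in>T. d j * g j)" .
  \<comment> \<open>Grouping by index only loses weight through cancellation, so the net
    multiplicities meet the bound required by \<open>lacunary_sum_bound\<close>.\<close>
  have "(\<Sum>j\<in>ind ` D. \<bar>d j\<bar>) \<le> (\<Sum>j\<in>ind ` D. \<Sum>k | k \<in> D \<and> ind k = j. \<bar>s k\<bar>)"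
    unfolding d_def by (intro sum_mono sum_abs)
  also have "\<dots> = (\<Sum>k\<in>D. \<bar>s k\<bar>)" using fin by (intro sum.group) auto
  also have "\<dots> = int (card D)" using s by simp
  finally have dsum: "(\<Sum>j\<in>ind ` D. \<bar>d j\<bar>) \<le> int l" using cD by linarith
  have dsum': "(\<Sum>j\<in>F. \<bar>d j\<bar>) \<le> int l" if "F \<subseteq> T" for F
  proof -
    have "(\<Sum>j\<in>F. \<bar>d j\<bar>) \<le> (\<Sum>j\<in>ind ` D. \<bar>d j\<bar>)"
      using that fin by (intro sum_mono2) (auto simp: T_def)
    then show ?thesis using dsum by linarith
  qed
  show ?thesis
  proof (cases "\<forall>j\<in>T. j < K")
    case True
    have rest: "\<bar>\<Sum>j\<in>T. d j * g j\<bar> \<le> a K"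
      using True l by (intro lacunary_sum_bound[OF lac finT, where l = l]) (auto simp: dsum')
    obtain k0 where k0: "k0 \<in> A" "ind k0 = K" using K(1) by auto
    \<comment> \<open>The term at \<open>k0\<close> pays for all of \<open>T\<close>; each of the at
      least \<open>l\<close> other terms is a positive integer.\<close>
    have "int (card (A - {k0})) * 1 \<le> (\<Sum>k\<in>A - {k0}. a (ind k))"
      using apos by (intro sum_bounded_below) (auto simp: int_one_le_iff_zero_less)
    moreover have "(\<Sum>k\<in>A. a (ind k)) = a K + (\<Sum>k\<in>A - {k0}. a (ind k))"
      using k0 fin by (subst sum.remove[of A k0]) auto
    moreover have "card (A - {k0}) \<ge> l" using k0 fin cA by simp
    ultimately show ?thesis using rest D_eq by linarith
  next
    case False
    define J where "J = Max T"
    have Tne: "T \<noteq> {}" using False by auto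
    have J: "J \<in> T" "\<And>j. j \<in> T \<Longrightarrow> j \<le> J"
      using finT Tne by (auto simp: J_def)
    have KJ: "K \<le> J" using False J(2) by (meson leI order_trans)
    have rest: "\<bar>\<Sum>j\<in>T - {J}. d j * g j\<bar> \<le> a J"
    proof (rule lacunary_sum_bound[OF lac, where l = l])
      show "j < J" if "j \<in> T - {J}" for j using J(2)[of j] that by auto
    qed (use finT dsum' l KJ in auto)
    have T_eq: "(\<Sum>j\<in>T. d j * g j) = d J * g J + (\<Sum>j\<in>T - {J}. d j * g j)"
      using J(1) finT by (subst sum.remove[of T J]) auto
    have A0: "(\<Sum>k\<in>A. a (ind k)) \<ge> 0" using apos by (intro sum_nonneg) (simp add: less_imp_le)
    have "(\<Sum>k\<in>A. a (ind k)) \<le> int (card A) * a J"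
      using K(2) KJ by (intro sum_bounded_above a_mono) force
    also have "\<dots> \<le> int ((J + 1) * (J + 2)) * a J"
    proof -
      have "card A \<le> l * (K + 2)" by (rule cA)
      also have "\<dots> \<le> (J + 1) * (J + 2)" using l KJ by (intro mult_mono) auto
      finally show ?thesis using apos[of J] by (intro mult_right_mono) (simp_all only: of_nat_le_iff less_imp_le)
    qed
    finally have Aub: "(\<Sum>k\<in>A. a (ind k)) \<le> (int J + 1) * (int J + 2) * a J" by (simp add: algebra_simps)
    \<comment> \<open>Splits \<open>(J + 2)^2 = (J + 1) * (J + 2) + 1 + (J + 1)\<close>: the parts
      cover the sum over \<open>A\<close>, the sum over \<open>T - {J}\<close>, and
      \<open>l\<close>.\<close>
    have gJ: "g J \<ge> (int J + 1) * (int J + 2) * a J + a J + (int J + 1) * a J"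
      using lac by (simp add: lacunary_def power2_eq_square algebra_simps)
    have "int l \<le> (int J + 1) * 1" using l KJ by simp
    also have "\<dots> \<le> (int J + 1) * a J" using apos[of J] by (intro mult_left_mono) auto
    finally have lJ: "int l \<le> (int J + 1) * a J" .
    have J0: "(int J + 1) * (int J + 2) * a J \<ge> 0" using apos[of J] by simp
    have g0: "g J \<ge> 0" using gJ J0 lJ apos[of J] by linarith
    from J(1) have "d J \<noteq> 0" by (simp add: T_def)
    then consider "d J \<ge> 1" | "d J \<le> -1" by linarith
    then show ?thesis
    proof cases
      case 1
      then have "1 * g J \<le> d J * g J" using g0 by (intro mult_right_mono)
      then show ?thesis using rest T_eq D_eq A0 gJ lJ J0 by linarith
    next
      case 2
      then have "d J * g J \<le> (-1) * g J" using g0 by (intro mult_right_mono)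
      then show ?thesis using rest T_eq D_eq Aub gJ lJ by linarith
    qed
  qed
qed

section \<open>Construction of the sequences and counting of the terms\<close>

theorem propositionA4:
  fixes \<xi> :: real
  assumes "\<xi> > 0" and "\<xi> \<notin> \<rat>"
  shows "\<exists>\<alpha> \<beta> \<gamma> :: nat \<Rightarrow> real.
    (\<forall>i\<ge>1. \<alpha> i \<in> M \<xi> \<and> \<beta> i \<in> M \<xi> \<and> \<gamma> i \<in> M \<xi>) \<and>
    \<alpha> \<longlonglongrightarrow> 0 \<and>
    \<gamma> \<longlonglongrightarrow> 1 \<and>
    (\<forall>i\<ge>1. \<gamma> i > 1) \<and>
    (\<forall>i\<ge>1. \<beta> i + \<gamma> i = 4) \<and>
    (\<forall>l\<ge>1. \<forall>n > n_bound l. S n (\<Union>i\<in>{1..}. {\<alpha> i, \<beta> i, \<gamma> i}) \<inter> B \<xi> l = {})"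
proof -
  obtain p a q g where lac: "lacunary a g"
    and \<alpha>l: "\<And>i. 1 / (real i + 2) < of_int (p i) + of_int (a i) * \<xi>"
    and \<alpha>u: "\<And>i. of_int (p i) + of_int (a i) * \<xi> < 1 / (real i + 1)"
    and \<gamma>l: "\<And>i. 1 < of_int (q i) + of_int (g i) * \<xi>"
    and \<gamma>u: "\<And>i. of_int (q i) + of_int (g i) * \<xi> < 1 + 1 / (real i + 1)"
    by (rule lacunary_approximations[OF assms(2)]) blast
  define \<alpha> where "\<alpha> i = of_int (p i) + of_int (a i) * \<xi>" for i
  define \<gamma> where "\<gamma> i = of_int (q i) + of_int (g i) * \<xi>" for i
  define \<beta> where "\<beta> i = 4 - \<gamma> i" for i
  have \<beta>_eq: "\<beta> i = of_int (4 - q i) + of_int (- g i) * \<xi>" for i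
    by (simp add: \<beta>_def \<gamma>_def)
  have \<alpha>pos: "0 < \<alpha> i" for i
    using \<alpha>l[of i] unfolding \<alpha>_def by (smt (verit) divide_pos_pos of_nat_0_le_iff)
  \<comment> \<open>This makes \<beta> exceed 2, which gives membership in \<open>M \<xi>\<close>
    and, below, a size of at least 1 for every term indexed by \<open>D\<close>.\<close>
  have \<gamma>2: "\<gamma> i < 2" for i
  proof -
    have "1 / (real i + 1) \<le> 1" by simp
    then show ?thesis using \<gamma>u[of i] unfolding \<gamma>_def by linarith
  qed
  have \<gamma>1: "\<gamma> i > 1" for i using \<gamma>l by (simp add: \<gamma>_def)
  have inM: "\<alpha> i \<in> M \<xi>" "\<beta> i \<in> M \<xi>" "\<gamma> i \<in> M \<xi>" for i
  proof -
    have "\<beta> i \<ge> 0" using \<gamma>2[of i] by (simp add: \<beta>_def)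
    then show "\<beta> i \<in> M \<xi>" unfolding M_def using \<beta>_eq[of i] by blast
  qed (use \<alpha>pos[of i] \<gamma>1[of i] in \<open>auto simp: M_def \<alpha>_def \<gamma>_def\<close>)
  have inv: "(\<lambda>i. 1 / (real i + 1)) \<longlonglongrightarrow> 0"
    using LIMSEQ_inverse_real_of_nat by (simp add: inverse_eq_divide add.commute)
  have lim\<alpha>: "\<alpha> \<longlonglongrightarrow> 0"
    by (rule tendsto_sandwich[OF _ _ tendsto_const inv])
       (use \<alpha>pos \<alpha>u in \<open>auto simp: \<alpha>_def intro!: always_eventually less_imp_le\<close>)
  have "(\<lambda>i. 1 + 1 / (real i + 1)) \<longlonglongrightarrow> 1 + 0" by (intro tendsto_add tendsto_const inv)
  then have inv1: "(\<lambda>i. 1 + 1 / (real i + 1)) \<longlonglongrightarrow> 1" by simp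
  have lim\<gamma>: "\<gamma> \<longlonglongrightarrow> 1"
    by (rule tendsto_sandwich[OF _ _ tendsto_const inv1])
       (use \<gamma>l \<gamma>u in \<open>auto simp: \<gamma>_def intro!: always_eventually less_imp_le\<close>)
  have "False" if l: "l \<ge> 1" and n: "n > n_bound l"
    and \<sigma>: "\<forall>k\<in>{1..n}. \<sigma> k \<in> (\<Union>i\<in>{1..}. {\<alpha> i, \<beta> i, \<gamma> i})"
    and xB: "(\<Sum>k=1..n. \<sigma> k) \<in> B \<xi> l" for l n \<sigma>
  proof -
    have "\<forall>k\<in>{1..n}. \<exists>i. \<sigma> k \<in> {\<alpha> i, \<beta> i, \<gamma> i}" using \<sigma> by blast
    then obtain ind where ind: "\<And>k. k \<in> {1..n} \<Longrightarrow> \<sigma> k \<in> {\<alpha> (ind k), \<beta> (ind k), \<gamma> (ind k)}"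
      by metis
    define A where "A = {k \<in> {1..n}. \<sigma> k = \<alpha> (ind k)}"
    define D where "D = {1..n} - A"
    \<comment> \<open>On \<open>D\<close> a term that is not a \<gamma> is a \<beta>, whose
      coefficient of \<xi> is \<open>- g (ind k)\<close>; \<open>r\<close> records the integer
      parts.\<close>
    define s :: "nat \<Rightarrow> int" where "s k = (if \<sigma> k = \<gamma> (ind k) then 1 else -1)" for k
    define r where "r k = (if \<sigma> k = \<gamma> (ind k) then q (ind k) else 4 - q (ind k))" for k
    have fin: "finite A" "finite D" by (auto simp: A_def D_def)
    have split: "(\<Sum>k=1..n. \<sigma> k) = (\<Sum>k\<in>A. \<sigma> k) + (\<Sum>k\<in>D. \<sigma> k)"
      unfolding D_def by (subst sum.subset_diff[of A]) (auto simp: A_def)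
    have \<sigma>D: "\<sigma> k = of_int (r k) + of_int (s k * g (ind k)) * \<xi>" if "k \<in> D" for k
      using ind[of k] that \<beta>_eq[of "ind k"] by (auto simp: D_def A_def s_def r_def \<gamma>_def)
    have \<sigma>A: "\<sigma> k = of_int (p (ind k)) + of_int (a (ind k)) * \<xi>" if "k \<in> A" for k
      using that by (simp add: A_def \<alpha>_def)
    have \<sigma>D1: "1 \<le> \<sigma> k" if "k \<in> D" for k
      using ind[of k] that \<gamma>1[of "ind k"] \<gamma>2[of "ind k"] by (auto simp: D_def A_def \<beta>_def)
    have A0: "0 \<le> (\<Sum>k\<in>A. \<sigma> k)"
      using \<alpha>pos by (intro sum_nonneg) (auto simp: A_def less_imp_le)
    have D0: "real (card D) \<le> (\<Sum>k\<in>D. \<sigma> k)"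
      using sum_bounded_below[of D 1 \<sigma>] \<sigma>D1 by simp
    have xl: "(\<Sum>k\<in>A. \<sigma> k) + (\<Sum>k\<in>D. \<sigma> k) < real l"
      using xB split by (simp add: B_def)
    have cD: "card D < l" using A0 D0 xl by linarith
    have "A \<union> D = {1..n}" "A \<inter> D = {}" by (auto simp: A_def D_def)
    then have "card A + card D = n" using card_Un_disjoint[OF fin] by simp
    then have cA: "l ^ 3 < card A" using cD n by (simp add: n_bound_def)
    have "l \<le> l ^ 3" using l by (simp add: self_le_power)
    with cA have lA: "l < card A" by simp
    then have Ane: "A \<noteq> {}" by auto
    define K where "K = Max (ind ` A)"
    have K: "K \<in> ind ` A" "\<And>k. k \<in> A \<Longrightarrow> ind k \<le> K"
      using fin Ane by (auto simp: K_def)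
    have "1 / (real K + 2) \<le> \<sigma> k" if "k \<in> A" for k
    proof -
      have "1 / (real K + 2) \<le> 1 / (real (ind k) + 2)"
        using K(2)[OF that] by (intro divide_left_mono) auto
      then show ?thesis using \<alpha>l[of "ind k"] \<sigma>A[OF that] by linarith
    qed
    then have "real (card A) * (1 / (real K + 2)) \<le> (\<Sum>k\<in>A. \<sigma> k)" by (rule sum_bounded_below)
    then have "real (card A) * (1 / (real K + 2)) < real l" using D0 xl by linarith
    then have "real (card A) < real (l * (K + 2))" by (simp add: field_simps)
    then have cA2: "card A < l * (K + 2)" by (simp only: of_nat_less_iff)
    \<comment> \<open>Cancelling \<open>l\<close> in \<open>l ^ 3 < card A < l * (K + 2)\<close>
      forces a large index \<open>K\<close>.\<close>
    have "l ^ 3 = l * l\<^sup>2" by (simp add: power2_eq_square power3_eq_cube)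
    with cA cA2 have "l * l\<^sup>2 < l * (K + 2)" by linarith
    then have "l\<^sup>2 \<le> K + 1" by (simp only: nat_mult_less_cancel1 mult_less_cancel1) linarith
    moreover have "l \<le> l\<^sup>2" using l by (simp add: power2_eq_square)
    ultimately have lK: "l \<le> K + 1" by linarith
    have "int l \<le> \<bar>(\<Sum>k\<in>A. a (ind k)) + (\<Sum>k\<in>D. s k * g (ind k))\<bar>"
      using l lK cD lA cA2 K
      by (intro lacunary_signed_sum_large[OF lac fin]) (auto simp: s_def)
    moreover have "(\<Sum>k=1..n. \<sigma> k) = of_int ((\<Sum>k\<in>A. p (ind k)) + (\<Sum>k\<in>D. r k)) +
        of_int ((\<Sum>k\<in>A. a (ind k)) + (\<Sum>k\<in>D. s k * g (ind k))) * \<xi>"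
      unfolding split using \<sigma>A \<sigma>D
      by (simp add: sum.distrib sum_distrib_left algebra_simps)
    then have "phi \<xi> (\<Sum>k=1..n. \<sigma> k) = (\<Sum>k\<in>A. a (ind k)) + (\<Sum>k\<in>D. s k * g (ind k))"
      by (simp only: phi_eq[OF assms(2)])
    ultimately show False using xB by (auto simp: B_def)
  qed
  then have "\<forall>l\<ge>1. \<forall>n > n_bound l. S n (\<Union>i\<in>{1..}. {\<alpha> i, \<beta> i, \<gamma> i}) \<inter> B \<xi> l = {}"
    unfolding S_def by blast
  with inM lim\<alpha> lim\<gamma> \<gamma>1 show ?thesis
    by (intro exI[of _ \<alpha>] exI[of _ \<beta>] exI[of _ \<gamma>]) (simp add: \<beta>_def)
qed

end
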